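(* Let $(X,\tau)$ be a topological space and let $\tau^s$ be its strong topology. Then $(X,\tau^s)$ is compact if and only if $(X,\tau)$ is both a Noetherian space and a co-Noetherian space.
   Context: No separation axioms are assumed; "compact" means that every open cover has a finite subcover. The strong topology (also called Skula topology) $\tau^s$ of $(X,\tau)$ is the topology on $X$ having as a subbase the family of all $\tau$-open sets together with all $\tau$-closed sets. A topological space is Noetherian if all of its open sets are compact. A filter basis of sets is a nonempty family of sets such that any two members contain a third member of the family. A topological space $(X,\tau)$ is co-Noetherian if for each open set $V$ and each filter basis $\mathcal{U}$ of open sets with $\bigcap\mathcal{U}\subseteq V$, there is a $U\in\mathcal{U}$ with $U\subseteq V$. *)

theory Defs
  imports "HOL-Analysis.Analysis"
begin

definition strong_topology :: "'a topology \<Rightarrow> 'a topology" where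
  "strong_topology X = topology_generated_by ({U. openin X U} \<union> {C. closedin X C})"

lemma topspace_strong_topology [simp]: "topspace (strong_topology X) = topspace X"
  unfolding strong_topology_def topology_generated_by_topspace
  by (auto dest: openin_subset closedin_subset)

definition Noetherian_space :: "'a topology \<Rightarrow> bool" where
  "Noetherian_space X \<longleftrightarrow> (\<forall>U. openin X U \<longrightarrow> compactin X U)"

(* Here a filter basis may contain the empty set. *)
definition filter_basis :: "'a set set \<Rightarrow> bool" where
  "filter_basis \<U> \<longleftrightarrow> \<U> \<noteq> {} \<and> (\<forall>A\<in>\<U>. \<forall>B\<in>\<U>. \<exists>C\<in>\<U>. C \<subseteq> A \<inter> B)"

definition co_Noetherian_space :: "'a topology \<Rightarrow> bool" where
  "co_Noetherian_space X \<longleftrightarrow>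
     (\<forall>V \<U>. openin X V \<and> filter_basis \<U> \<and> (\<forall>U\<in>\<U>. openin X U) \<and> \<Inter>\<U> \<subseteq> V
        \<longrightarrow> (\<exists>U\<in>\<U>. U \<subseteq> V))"

end

(* For the backward direction, Alexander's subbase theorem reduces to covers by open sets Os and
   closed sets Cs. The complements of finite unions from Cs form a filter basis of open sets whose
   intersection lies in the union of Os; co-Noetherianness picks one such complement inside that
   union, and being open it is compact by Noetherianness. *)

theory Submission
  imports Defs
begin

text \<open>Bridges the inductively generated topology behind \<open>strong_topology\<close> and the
  subbase form that \<open>Alexander_subbase\<close> expects. Both are the least topology containing
  \<open>\<B>\<close> in which \<open>\<Union>\<B>\<close> is open.\<close>

lemma topology_generated_by_eq_subbase:
  "topology_generated_by \<B> =
     topology (arbitrary union_of (finite intersection_of (\<lambda>x. x \<in> \<B>) relative_to \<Union>\<B>))"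
    (is "?G = ?T")
proof -
  have "openin ?T S" if "generate_topology_on \<B> S" for S
    using that
  proof induction
    case (Basis s)
    then have "s = \<Union>\<B> \<inter> s"
      by blast
    moreover have "(finite intersection_of (\<lambda>x. x \<in> \<B>) relative_to \<Union>\<B>) (\<Union>\<B> \<inter> s)"
      by (intro relative_to_inc finite_intersection_of_inc Basis)
    ultimately show ?case
      unfolding openin_subbase by (metis arbitrary_union_of_inc)
  qed auto
  moreover have "openin ?G S" if "openin ?T S" for S
  proof (rule minimal_topology_subbase [OF _ _ that])
    show "openin ?G (\<Union>\<B>)"
      by (metis openin_topspace topology_generated_by_topspace)
  qed (rule topology_generated_by_Basis)
  ultimately show ?thesis
    unfolding topology_eq openin_topology_generated_by_iff by blast
qed

lemma
  shows openin_strong_topologyI: "openin X U \<Longrightarrow> openin (strong_topology X) U"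
    and closedin_imp_openin_strong_topology: "closedin X U \<Longrightarrow> openin (strong_topology X) U"
  by (auto simp: strong_topology_def topology_generated_by_Basis)

lemma filter_basis_finite_Inter:
  assumes "filter_basis \<U>" "finite \<F>" "\<F> \<subseteq> \<U>"
  shows "\<exists>U\<in>\<U>. U \<subseteq> \<Inter>\<F>"
  using assms(2,3)
proof induction
  case empty
  \<comment> \<open>Here \<open>\<Inter>{}\<close> is \<open>UNIV\<close>, so any member will do;
    nonemptiness of the basis supplies one.\<close>
  with assms(1) show ?case
    by (auto simp: filter_basis_def)
next
  case (insert A \<F>)
  then obtain U where U: "U \<in> \<U>" "U \<subseteq> \<Inter>\<F>"
    by auto
  moreover obtain W where "W \<in> \<U>" "W \<subseteq> A \<inter> U"
    using assms(1) insert.prems U by (meson filter_basis_def insert_subset)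
  ultimately show ?case
    by auto
qed

text \<open>Open sets of \<open>X\<close> become clopen in the strong topology, hence compact there,
  and compactness survives passage to the coarser topology.\<close>

lemma Noetherian_space_if_compact_strong:
  assumes "compact_space (strong_topology X)"
  shows "Noetherian_space X"
  unfolding Noetherian_space_def
proof (intro strip)
  fix U assume U: "openin X U"
  then have "closedin (strong_topology X) U"
    by (simp add: closedin_def openin_subset closedin_imp_openin_strong_topology
        openin_closedin_eq [of X U])
  then have "compactin (strong_topology X) U"
    by (rule closedin_compact_space [OF assms])
  then show "compactin X U"
    by (rule compactin_contractive) (auto intro: openin_strong_topologyI)
qed

text \<open>The inclusion \<open>\<Inter>\<U> \<subseteq> V\<close> says that \<open>V\<close> and
  the complements of members of \<open>\<U>\<close> cover the space. A finite subcover involves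
  finitely many members of \<open>\<U>\<close>, and any member below all of them must lie in
  \<open>V\<close>.\<close>

lemma co_Noetherian_space_if_compact_strong:
  assumes "compact_space (strong_topology X)"
  shows "co_Noetherian_space X"
  unfolding co_Noetherian_space_def
proof (intro strip, elim conjE)
  fix V \<U>
  assume V: "openin X V" and \<U>: "filter_basis \<U>" "\<forall>U\<in>\<U>. openin X U" "\<Inter>\<U> \<subseteq> V"
  let ?\<C> = "(\<lambda>U. topspace X - U) ` \<U>"
  have "\<forall>W \<in> insert V ?\<C>. openin (strong_topology X) W"
    using V \<U>(2) by (auto intro: openin_strong_topologyI closedin_imp_openin_strong_topology)
  moreover have "topspace (strong_topology X) \<subseteq> \<Union>(insert V ?\<C>)"
    using \<U>(3) by auto
  ultimately obtain \<F> where \<F>: "finite \<F>" "\<F> \<subseteq> insert V ?\<C>" "topspace X \<subseteq> \<Union>\<F>"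
    using assms unfolding compact_space_alt by (metis topspace_strong_topology)
  then have "finite (\<F> - {V})" "\<F> - {V} \<subseteq> ?\<C>"
    by auto
  then obtain \<G> where \<G>: "finite \<G>" "\<G> \<subseteq> \<U>" "\<F> - {V} = (\<lambda>U. topspace X - U) ` \<G>"
    by (meson finite_subset_image)
  obtain U where U: "U \<in> \<U>" "U \<subseteq> \<Inter>\<G>"
    using filter_basis_finite_Inter [OF \<U>(1) \<G>(1,2)] by blast
  have "U \<subseteq> V"
  proof
    fix x assume x: "x \<in> U"
    have "U \<subseteq> topspace X"
      using U(1) \<U>(2) by (simp add: openin_subset)
    with x \<F>(3) obtain W where W: "W \<in> \<F>" "x \<in> W"
      by (meson UnionE subsetD)
    \<comment> \<open>The point \<open>x\<close> lies in every member of \<open>\<G>\<close>, so no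
      complement can cover it; only \<open>V\<close> remains.\<close>
    have "W \<notin> (\<lambda>U. topspace X - U) ` \<G>"
      using W(2) x U(2) by auto
    then have "W = V"
      using W(1) unfolding \<G>(3) [symmetric] by simp
    with W(2) show "x \<in> V"
      by simp
  qed
  with U(1) show "\<exists>U\<in>\<U>. U \<subseteq> V"
    by blast
qed

lemma compact_strong_if_Noetherian_co_Noetherian:
  assumes "Noetherian_space X" "co_Noetherian_space X"
  shows "compact_space (strong_topology X)"
proof (rule Alexander_subbase)
  let ?\<B> = "{U. openin X U} \<union> {C. closedin X C}"
  show "topology (arbitrary union_of (finite intersection_of (\<lambda>x. x \<in> ?\<B>) relative_to \<Union>?\<B>))
          = strong_topology X"
    by (simp only: strong_topology_def topology_generated_by_eq_subbase)
  fix \<A> assume \<A>: "\<A> \<subseteq> ?\<B>" "\<Union>\<A> = topspace (strong_topology X)"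
  \<comment> \<open>The two classes may share clopen sets; it is enough that together they exhaust
    \<open>\<A>\<close>.\<close>
  define \<C> where "\<C> = {C \<in> \<A>. closedin X C}"
  define \<O> where "\<O> = {U \<in> \<A>. openin X U}"
  define \<U> where "\<U> = (\<lambda>\<F>. topspace X - \<Union>\<F>) ` {\<F>. finite \<F> \<and> \<F> \<subseteq> \<C>}"
  have open_\<U>: "\<forall>U\<in>\<U>. openin X U"
    by (auto simp: \<U>_def \<C>_def intro!: closedin_Union)
  have "\<exists>W\<in>\<U>. W \<subseteq> A \<inter> B" if AB: "A \<in> \<U>" "B \<in> \<U>" for A B
  proof -
    obtain \<F> \<G> where "finite \<F>" "\<F> \<subseteq> \<C>" "A = topspace X - \<Union>\<F>"
      "finite \<G>" "\<G> \<subseteq> \<C>" "B = topspace X - \<Union>\<G>"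
      using AB by (auto simp: \<U>_def)
    then have "topspace X - \<Union>(\<F> \<union> \<G>) \<in> \<U>" "topspace X - \<Union>(\<F> \<union> \<G>) \<subseteq> A \<inter> B"
      unfolding \<U>_def by (blast intro: finite_UnI)+
    then show ?thesis
      by blast
  qed
  moreover have "\<U> \<noteq> {}"
    by (auto simp: \<U>_def)
  ultimately have "filter_basis \<U>"
    by (simp add: filter_basis_def)
  moreover have "\<Inter>\<U> \<subseteq> \<Union>\<O>"
  proof
    fix x assume x: "x \<in> \<Inter>\<U>"
    \<comment> \<open>The empty subfamily puts the whole space into \<open>\<U>\<close>, so
      \<open>x\<close> is a point of the space and is covered by \<open>\<A>\<close>.\<close>
    have "topspace X - \<Union>{} \<in> \<U>"
      unfolding \<U>_def by blast
    with x have "x \<in> \<Union>\<A>"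
      using \<A>(2) by auto
    then obtain A where A: "A \<in> \<A>" "x \<in> A"
      by blast
    have "A \<notin> \<C>"
    proof
      assume "A \<in> \<C>"
      then have "topspace X - \<Union>{A} \<in> \<U>"
        unfolding \<U>_def by blast
      with x A(2) show False
        by auto
    qed
    with A \<A>(1) show "x \<in> \<Union>\<O>"
      by (auto simp: \<C>_def \<O>_def)
  qed
  moreover have "openin X (\<Union>\<O>)"
    by (auto simp: \<O>_def)
  ultimately obtain U where U: "U \<in> \<U>" "U \<subseteq> \<Union>\<O>"
    using assms(2) open_\<U> unfolding co_Noetherian_space_def by metis
  then obtain \<F> where \<F>: "finite \<F>" "\<F> \<subseteq> \<C>" "U = topspace X - \<Union>\<F>"
    by (auto simp: \<U>_def)
  have "compactin X U"
    using assms(1) U(1) open_\<U> by (simp add: Noetherian_space_def)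
  moreover have "openin X W" if "W \<in> \<O>" for W
    using that by (simp add: \<O>_def)
  ultimately obtain \<G> where \<G>: "finite \<G>" "\<G> \<subseteq> \<O>" "U \<subseteq> \<Union>\<G>"
    using compactinD [OF _ _ U(2)] by metis
  \<comment> \<open>\<open>\<G>\<close> covers \<open>U\<close> and \<open>\<F>\<close> covers its
    complement, so together they form the finite subcover.\<close>
  have sub: "\<F> \<union> \<G> \<subseteq> \<A>"
    using \<F>(2) \<G>(2) by (auto simp: \<C>_def \<O>_def)
  then have "\<Union>(\<F> \<union> \<G>) \<subseteq> topspace X"
    using \<A>(2) by auto
  moreover have "topspace X \<subseteq> \<Union>(\<F> \<union> \<G>)"
    using \<F>(3) \<G>(3) by auto
  ultimately show "\<exists>C'. finite C' \<and> C' \<subseteq> \<A> \<and> \<Union>C' = topspace (strong_topology X)"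
    using \<F>(1) \<G>(1) sub by (intro exI [of _ "\<F> \<union> \<G>"]) auto
qed

theorem theorem4p7:
  fixes X :: "'a topology"
  shows "compact_space (strong_topology X) \<longleftrightarrow> Noetherian_space X \<and> co_Noetherian_space X"
  using Noetherian_space_if_compact_strong co_Noetherian_space_if_compact_strong
    compact_strong_if_Noetherian_co_Noetherian by blast

end
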